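(* Let $\alpha,\beta,\gamma,b,c,z\in\mathbb{C}$ and $p\ge 0$ with $\mathrm{Re}(c)>\mathrm{Re}(b)>0$ and $\mathrm{Re}(\alpha)>0$. Then $${}^{ML}\Phi_{p}(b;c;z)=\frac{1}{B(b,c-b)}\int_{0}^{1}t^{b-1}(1-t)^{c-b-1}e^{zt}E_{\alpha,\beta}^{\gamma}\left(-\frac{p}{t(1-t)}\right)dt,$$ $${}^{ML}\Phi_{p}(b;c;z)=\frac{1}{B(b,c-b)}\int_{0}^{1}t^{c-b-1}(1-t)^{b-1}e^{z(1-t)}E_{\alpha,\beta}^{\gamma}\left(-\frac{p}{t(1-t)}\right)dt.$$
   Context: The three-parameter Mittag-Leffler function is $E_{\alpha,\beta}^{\gamma}(z)=\sum_{n=0}^{\infty}\frac{(\gamma)_n}{\Gamma(\alpha n+\beta)}\frac{z^n}{n!}$ for $\alpha,\beta,\gamma\in\mathbb{C}$, $\mathrm{Re}(\alpha)>0$, where $(\gamma)_n=\gamma(\gamma+1)\cdots(\gamma+n-1)$, $(\gamma)_0=1$. The ML-generalized beta function is ${}^{ML}B_{p}(x,y)=\int_{0}^{1}t^{x-1}(1-t)^{y-1}E_{\alpha,\beta}^{\gamma}\left(-\frac{p}{t(1-t)}\right)dt$ for $\mathrm{Re}(x)>0$, $\mathrm{Re}(y)>0$ (the parameters $\alpha,\beta,\gamma$ are suppressed in the notation), and $B(x,y)=\int_0^1 t^{x-1}(1-t)^{y-1}dt$ is the classical beta function. The ML-generalized confluent hypergeometric function is ${}^{ML}\Phi_{p}(b;c;z)=\sum_{n=0}^{\infty}\frac{{}^{ML}B_{p}(b+n,c-b)}{B(b,c-b)}\frac{z^n}{n!}$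 for $p\ge 0$, $\mathrm{Re}(c)>\mathrm{Re}(b)>0$, $\mathrm{Re}(\alpha)>0$.
   Formalization: The formal theorem additionally assumes that the integral defining B_p(b,c−b) converges; without this both sides can be undefined, e.g. for γ=−1, α=β=1, p=1, b=1/2, c=3, where the integrand behaves like t^(−3/2) near 0. *)

theory Defs
  imports "HOL-Analysis.Analysis"
begin

text \<open>
  The library defines \<^const>\<open>Beta\<close> through the Gamma function and relates it to Euler's integral
  for real arguments only; the following lemmas do so for complex arguments.
\<close>

definition gamma_kernel :: "complex \<Rightarrow> real \<Rightarrow> complex" where
  "gamma_kernel a t = indicator {0<..} t *\<^sub>R exp ((a - 1) * of_real (ln t) - of_real t)"

lemma gamma_kernel_eq:
  "gamma_kernel a t = indicator {0<..} t *\<^sub>R (of_real t powr (a - 1) / of_real (exp t))"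
  by (auto simp: gamma_kernel_def indicator_def powr_def exp_diff Ln_of_real exp_of_real)

lemma gamma_kernel_measurable [measurable]: "gamma_kernel a \<in> borel_measurable borel"
  unfolding gamma_kernel_def by measurable

lemma gamma_kernel_integral:
  assumes "Re a > 0"
  shows "integrable lborel (gamma_kernel a)" "integral\<^sup>L lborel (gamma_kernel a) = Gamma a"
proof -
  have "integrable lebesgue (gamma_kernel a)"
    using absolutely_integrable_Gamma_integral'[OF assms]
    by (simp add: set_integrable_def gamma_kernel_eq[abs_def])
  thus *: "integrable lborel (gamma_kernel a)"
    by (subst (asm) integrable_completion) auto
  have "(gamma_kernel a has_integral integral\<^sup>L lborel (gamma_kernel a)) UNIV"
    using * by (rule has_integral_integral_lborel)
  moreover have "((\<lambda>t. if t \<in> {0<..} then of_real t powr (a - 1) / of_real (exp t) else 0) 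
      has_integral Gamma a) UNIV"
    using Gamma_integral_complex'[OF assms] by (subst has_integral_restrict_UNIV)
  hence "(gamma_kernel a has_integral Gamma a) UNIV"
    by (rule has_integral_eq[rotated]) (auto simp: gamma_kernel_eq)
  ultimately show "integral\<^sup>L lborel (gamma_kernel a) = Gamma a"
    by (rule has_integral_unique)
qed

lemma norm_gamma_kernel: "norm (gamma_kernel a t) = Re (gamma_kernel (of_real (Re a)) t)"
proof -
  have "gamma_kernel (of_real (Re a)) t =
          of_real (indicator {0<..} t * exp ((Re a - 1) * ln t - t))"
    by (simp add: gamma_kernel_def scaleR_conv_of_real flip: exp_of_real)
  thus ?thesis by (simp add: gamma_kernel_def indicator_def)
qed

definition beta_kernel :: "complex \<Rightarrow> complex \<Rightarrow> real \<Rightarrow> complex" where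
  "beta_kernel a b t = indicator {0<..<1} t *\<^sub>R
     exp ((a - 1) * of_real (ln t) + (b - 1) * of_real (ln (1 - t)))"

lemma beta_kernel_eq:
  "beta_kernel a b t = indicator {0<..<1} t *\<^sub>R
     (of_real t powr (a - 1) * of_real (1 - t) powr (b - 1))"
  by (auto simp: beta_kernel_def indicator_def powr_def exp_add Ln_of_real
           simp del: of_real_diff)

lemma gamma_kernel_convolution:
  "(\<integral>t. gamma_kernel a t * gamma_kernel b (u - t) \<partial>lborel) =
     gamma_kernel (a + b) u * (\<integral>t. beta_kernel a b t \<partial>lborel)"
proof (cases "u > 0")
  case False
  hence "(\<lambda>t. gamma_kernel a t * gamma_kernel b (u - t)) = (\<lambda>_. 0)"
    by (auto simp: gamma_kernel_def indicator_def)
  thus ?thesis using False by (simp only:) (simp add: gamma_kernel_def)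
next
  case True
  have *: "gamma_kernel a (0 + u * t) * gamma_kernel b (u - (0 + u * t)) =
             exp ((a + b - 2) * of_real (ln u) - of_real u) * beta_kernel a b t" for t
  proof (cases "t \<in> {0<..<1}")
    case False
    thus ?thesis using True
      by (auto simp: gamma_kernel_def beta_kernel_def indicator_def zero_less_mult_iff)
  next
    case t: True
    have "u - u * t = u * (1 - t)" by (simp add: algebra_simps)
    moreover have "u * (1 - t) > 0" using t True by simp
    ultimately show ?thesis using t True
      by (simp add: gamma_kernel_def beta_kernel_def ln_mult flip: exp_add)
         (simp add: algebra_simps)
  qed
  have "(\<integral>t. gamma_kernel a t * gamma_kernel b (u - t) \<partial>lborel) =
          u *\<^sub>R (\<integral>t. gamma_kernel a (0 + u * t) * gamma_kernel b (u - (0 + u * t)) \<partial>lborel)"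
    using True by (subst lborel_integral_real_affine[where c = u and t = 0]) auto
  also have "\<dots> = (u *\<^sub>R exp ((a + b - 2) * of_real (ln u) - of_real u)) *
                    (\<integral>t. beta_kernel a b t \<partial>lborel)"
    unfolding * by simp
  also have "u *\<^sub>R exp ((a + b - 2) * of_real (ln u) - of_real u) = gamma_kernel (a + b) u"
  proof -
    have "complex_of_real u = exp (of_real (ln u))"
      using True by (simp add: exp_of_real)
    hence "u *\<^sub>R exp ((a + b - 2) * of_real (ln u) - of_real u) =
             exp (of_real (ln u) + ((a + b - 2) * of_real (ln u) - of_real u))"
      by (simp add: scaleR_conv_of_real exp_add)
    thus ?thesis using True by (simp add: gamma_kernel_def algebra_simps)
  qed
  finally show ?thesis .
qed

lemma beta_kernel_integrable:
  assumes "Re a > 0" "Re b > 0"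
  shows "integrable lborel (beta_kernel a b)"
proof (rule Bochner_Integration.integrable_bound[OF _ _ AE_I2])
  show "integrable lborel (\<lambda>t. indicator {0..1} t *\<^sub>R (t powr (Re a - 1) * (1 - t) powr (Re b - 1)))"
    using integrable_Beta[OF assms] by (simp add: set_integrable_def)
  show "beta_kernel a b \<in> borel_measurable lborel"
    unfolding beta_kernel_def by measurable
  show "norm (beta_kernel a b t) \<le>
      norm (indicator {0..1} t *\<^sub>R (t powr (Re a - 1) * (1 - t) powr (Re b - 1)))" for t
    by (auto simp: beta_kernel_def indicator_def powr_def simp flip: exp_add)
qed

theorem has_integral_Beta_complex:
  fixes a b :: complex
  assumes a: "Re a > 0" and b: "Re b > 0"
  shows "((\<lambda>t. of_real t powr (a - 1) * of_real (1 - t) powr (b - 1)) has_integral Beta a b) {0..1}"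
proof -
  define F where "F = (\<lambda>t u. gamma_kernel a t * gamma_kernel b (u - t))"
  have shift: "(\<integral>u. f (u - t) \<partial>lborel) = (\<integral>u. f u \<partial>lborel)"
    for f :: "real \<Rightarrow> complex" and t
    using lborel_integral_real_affine[where c = 1 and t = "-t" and f = f] by simp
  have shift_int: "integrable lborel (\<lambda>u. gamma_kernel b (u - t))" for t
    using lborel_integrable_real_affine[OF gamma_kernel_integral(1)[OF b], of 1 "-t"] by simp
  have meas [measurable]: "case_prod F \<in> borel_measurable (lborel \<Otimes>\<^sub>M lborel)"
    unfolding F_def case_prod_unfold by measurable
  have norm_int: "(\<integral>u. norm (F t u) \<partial>lborel) =
      norm (gamma_kernel a t) * (\<integral>u. norm (gamma_kernel b u) \<partial>lborel)" for t
  proof -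
    have "(\<integral>u. norm (gamma_kernel b (u - t)) \<partial>lborel) = (\<integral>u. norm (gamma_kernel b u) \<partial>lborel)"
      using lborel_integral_real_affine[where c = 1 and t = "-t" and f = "\<lambda>u. norm (gamma_kernel b u)"]
      by simp
    thus ?thesis by (simp add: F_def norm_mult)
  qed
  have int: "integrable (lborel \<Otimes>\<^sub>M lborel) (case_prod F)"
  proof (rule lborel_pair.Fubini_integrable)
    show "integrable lborel (\<lambda>t. \<integral>u. norm (case_prod F (t, u)) \<partial>lborel)"
      using gamma_kernel_integral(1)[OF a] by (simp add: norm_int)
    show "AE t in lborel. integrable lborel (\<lambda>u. case_prod F (t, u))"
      using shift_int by (simp add: F_def)
  qed (rule meas)
  have "Gamma a * Gamma b = (\<integral>t. \<integral>u. F t u \<partial>lborel \<partial>lborel)"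
    using shift[of "gamma_kernel b"] gamma_kernel_integral[OF a] gamma_kernel_integral[OF b]
    by (simp add: F_def)
  also have "\<dots> = (\<integral>u. \<integral>t. F t u \<partial>lborel \<partial>lborel)"
    using lborel_pair.Fubini_integral[OF int] by simp
  also have "\<dots> = Gamma (a + b) * (\<integral>t. beta_kernel a b t \<partial>lborel)"
    using gamma_kernel_integral[of "a + b"] a b by (simp add: F_def gamma_kernel_convolution)
  finally have "Gamma a * Gamma b = Gamma (a + b) * (\<integral>t. beta_kernel a b t \<partial>lborel)" .
  moreover have "Gamma (a + b) \<noteq> 0"
    using a b by (auto simp: Gamma_eq_zero_iff elim!: nonpos_Ints_cases)
       (metis add_pos_pos not_less of_int_0_le_iff plus_complex.sel(1) Re_complex_of_real of_real_of_int_eq of_int_le_0_iff)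
  ultimately have *: "(\<integral>t. beta_kernel a b t \<partial>lborel) = Beta a b"
    by (simp add: Beta_def field_simps)
  have "(beta_kernel a b has_integral Beta a b) UNIV"
    using has_integral_integral_lborel[OF beta_kernel_integrable[OF a b]] * by simp
  also have "beta_kernel a b = (\<lambda>t. if t \<in> {0<..<1} then
               of_real t powr (a - 1) * of_real (1 - t) powr (b - 1) else 0)"
    by (auto simp: fun_eq_iff beta_kernel_eq)
  finally show ?thesis
    by (subst (asm) has_integral_restrict_UNIV) (simp add: has_integral_Icc_iff_Ioo)
qed

text \<open>
  A summand in which \<open>\<alpha> n + \<beta>\<close> is a pole of the Gamma function is 0, in agreement with the
  convention \<open>1 / \<Gamma> = 0\<close> at the poles: there \<^const>\<open>Gamma\<close> is 0, and division by 0 gives 0.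
\<close>
definition mittag_leffler3 :: "complex \<Rightarrow> complex \<Rightarrow> complex \<Rightarrow> complex \<Rightarrow> complex" where
  "mittag_leffler3 \<alpha> \<beta> \<gamma> z =
     (\<Sum>n. pochhammer \<gamma> n / Gamma (\<alpha> * of_nat n + \<beta>) * (z ^ n / fact n))"

definition beta_ML_integrand ::
  "complex \<Rightarrow> complex \<Rightarrow> complex \<Rightarrow> real \<Rightarrow> complex \<Rightarrow> complex \<Rightarrow> real \<Rightarrow> complex" where
  "beta_ML_integrand \<alpha> \<beta> \<gamma> p x y t =
     of_real t powr (x - 1) * of_real (1 - t) powr (y - 1) *
     mittag_leffler3 \<alpha> \<beta> \<gamma> (of_real (- (p / (t * (1 - t)))))"

text \<open>
  Integrals over \<open>{0..1}\<close> are Henstock-Kurzweil integrals, which subsume both the Lebesgue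
  and the improper Riemann integral; the values of the integrand at the end points are irrelevant.
  For \<open>p > 0\<close> the integral may diverge although \<open>Re x, Re y > 0\<close>: for \<open>\<gamma> = -1\<close> the Mittag-Leffler
  factor grows like \<open>1 / (t (1 - t))\<close>. Convergence must therefore be assumed where it is needed.
\<close>
definition beta_ML ::
  "complex \<Rightarrow> complex \<Rightarrow> complex \<Rightarrow> real \<Rightarrow> complex \<Rightarrow> complex \<Rightarrow> complex" where
  "beta_ML \<alpha> \<beta> \<gamma> p x y = integral {0..1} (beta_ML_integrand \<alpha> \<beta> \<gamma> p x y)"

definition Phi_ML_summand ::
  "complex \<Rightarrow> complex \<Rightarrow> complex \<Rightarrow> real \<Rightarrow> complex \<Rightarrow> complex \<Rightarrow> complex \<Rightarrow> nat \<Rightarrow> complex" where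
  "Phi_ML_summand \<alpha> \<beta> \<gamma> p b c z n =
     beta_ML \<alpha> \<beta> \<gamma> p (b + of_nat n) (c - b) / Beta b (c - b) * (z ^ n / fact n)"

definition Phi_ML ::
  "complex \<Rightarrow> complex \<Rightarrow> complex \<Rightarrow> real \<Rightarrow> complex \<Rightarrow> complex \<Rightarrow> complex \<Rightarrow> complex" where
  "Phi_ML \<alpha> \<beta> \<gamma> p b c z = (\<Sum>n. Phi_ML_summand \<alpha> \<beta> \<gamma> p b c z n)"

end

theory Submission
  imports Defs
begin

text \<open>
  The integrand of the beta function is only Henstock-Kurzweil integrable, possibly not absolutely,
  so dominated convergence does not apply. The second mean value theorem replaces it: integrating
  \<open>f\<close> against nonnegative increasing weights \<open>g\<close> on \<open>{a..b}\<close> gives at most a constant times \<open>g b\<close>.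
  A power series with nonnegative coefficients is such a weight on \<open>{0..1}\<close>, and so are its
  remainders, whose value at 1 tends to 0; hence it can be integrated against \<open>f\<close> term by term.
  General coefficients are combinations of nonnegative ones, and the theorem is the case of the
  coefficients \<open>z ^ n / n!\<close>.
\<close>

section \<open>Integration against monotone weights\<close>

lemma monotone_weight_integral_bound_real:
  fixes f :: "real \<Rightarrow> real"
  assumes f: "f integrable_on {a..b}" and "a \<le> b"
  obtains K where
    "\<And>g :: real \<Rightarrow> real. mono_on {a..b} g \<Longrightarrow> g a \<ge> 0 \<Longrightarrow>
           \<exists>I. ((\<lambda>x. g x * f x) has_integral I) {a..b} \<and> \<bar>I\<bar> \<le> K * g b"
proof -
  \<comment> \<open>The indefinite integral is continuous on a compact interval, hence bounded. The
    bound \<open>C\<close> depends on \<open>f\<close> alone, which makes the final constant uniform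
    in the weight \<open>g\<close>.\<close>
  have "bounded ((\<lambda>x. integral {a..x} f) ` {a..b})"
    by (intro compact_imp_bounded compact_continuous_image indefinite_integral_continuous_1 f) simp
  then obtain C where C: "\<And>x. x \<in> {a..b} \<Longrightarrow> \<bar>integral {a..x} f\<bar> \<le> C"
    unfolding bounded_iff by fastforce
  show thesis
  proof
    fix g :: "real \<Rightarrow> real" assume mono: "mono_on {a..b} g" and "g a \<ge> 0"
    have g: "g x \<le> g y" if "a \<le> x" "x \<le> y" "y \<le> b" for x y
      using that by (intro mono_onD[OF mono]) auto
    obtain c where c: "c \<in> {a..b}" and I: "((\<lambda>x. g x * f x) has_integral
        (g a * integral {a..c} f + g b * integral {c..b} f)) {a..b}"
      using second_mean_value_theorem_full[where g = g, OF f \<open>a \<le> b\<close> g] by blast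
    have "integral {a..c} f + integral {c..b} f = integral {a..b} f"
      using c f by (intro Henstock_Kurzweil_Integration.integral_combine) auto
    \<comment> \<open>The integral over \<open>{c..b}\<close> is a difference of two values of the
      indefinite integral, each at most \<open>C\<close> in absolute value. Together with the term
      at \<open>g a\<close>, where \<open>0 \<le> g a \<le> g b\<close>, this gives the constant
      \<open>3 * C\<close>.\<close>
    hence "\<bar>integral {c..b} f\<bar> \<le> 2 * C"
      using C[OF c] C[of b] \<open>a \<le> b\<close> by auto
    moreover have "\<bar>g a * integral {a..c} f\<bar> \<le> g b * C"
      unfolding abs_mult using C[OF c] \<open>g a \<ge> 0\<close> g[of a b] \<open>a \<le> b\<close> by (intro mult_mono) auto
    moreover have "g b \<ge> 0" using \<open>g a \<ge> 0\<close> g[of a b] \<open>a \<le> b\<close> by simp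
    ultimately have "\<bar>g a * integral {a..c} f + g b * integral {c..b} f\<bar> \<le> g b * C + g b * (2 * C)"
      by (intro order_trans[OF abs_triangle_ineq] add_mono) (auto simp: abs_mult mult_left_mono)
    with I show "\<exists>I. ((\<lambda>x. g x * f x) has_integral I) {a..b} \<and> \<bar>I\<bar> \<le> 3 * C * g b"
      by (intro exI conjI) (auto simp: algebra_simps)
  qed
qed

text \<open>The weight is real, so the real and imaginary parts of \<open>f\<close> can be treated
  separately. Their constants add up, since the norm is at most the sum of the absolute values of
  the two parts.\<close>

lemma monotone_weight_integral_bound:
  fixes f :: "real \<Rightarrow> complex"
  assumes f: "f integrable_on {a..b}" and "a \<le> b"
  obtains K where
    "\<And>g :: real \<Rightarrow> real. mono_on {a..b} g \<Longrightarrow> g a \<ge> 0 \<Longrightarrow>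
           (\<lambda>x. of_real (g x) * f x) integrable_on {a..b} \<and>
           norm (integral {a..b} (\<lambda>x. of_real (g x) * f x)) \<le> K * g b"
proof -
  have Re: "(\<lambda>x. Re (f x)) integrable_on {a..b}" and Im: "(\<lambda>x. Im (f x)) integrable_on {a..b}"
    using f has_integral_Re has_integral_Im unfolding integrable_on_def by blast+
  obtain K where
    K: "\<And>g :: real \<Rightarrow> real. mono_on {a..b} g \<Longrightarrow> g a \<ge> 0 \<Longrightarrow>
          \<exists>I. ((\<lambda>x. g x * Re (f x)) has_integral I) {a..b} \<and> \<bar>I\<bar> \<le> K * g b"
    by (rule monotone_weight_integral_bound_real[OF Re \<open>a \<le> b\<close>]) blast
  obtain L where
    L: "\<And>g :: real \<Rightarrow> real. mono_on {a..b} g \<Longrightarrow> g a \<ge> 0 \<Longrightarrow>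
          \<exists>I. ((\<lambda>x. g x * Im (f x)) has_integral I) {a..b} \<and> \<bar>I\<bar> \<le> L * g b"
    by (rule monotone_weight_integral_bound_real[OF Im \<open>a \<le> b\<close>]) blast
  show thesis
  proof
    fix g :: "real \<Rightarrow> real" assume g: "mono_on {a..b} g" "g a \<ge> 0"
    obtain I J where I: "((\<lambda>x. g x * Re (f x)) has_integral I) {a..b}" "\<bar>I\<bar> \<le> K * g b"
      and J: "((\<lambda>x. g x * Im (f x)) has_integral J) {a..b}" "\<bar>J\<bar> \<le> L * g b"
      using K[OF g] L[OF g] by blast
    have *: "((\<lambda>x. of_real (g x) * f x) has_integral Complex I J) {a..b}"
      using I(1) J(1)
      by (subst has_integral_componentwise_iff) (auto simp: Basis_complex_def inner_complex_def)
    moreover have "norm (Complex I J) \<le> (K + L) * g b"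
      using cmod_le[of "Complex I J"] I(2) J(2) by (simp add: algebra_simps)
    ultimately show "(\<lambda>x. of_real (g x) * f x) integrable_on {a..b} \<and>
        norm (integral {a..b} (\<lambda>x. of_real (g x) * f x)) \<le> (K + L) * g b"
      by (auto simp: integral_unique)
  qed
qed

section \<open>Termwise integration of power series on the unit interval\<close>

lemma power_moment_integrable:
  fixes f :: "real \<Rightarrow> complex"
  assumes "f integrable_on {0..1}"
  shows "(\<lambda>t. of_real t ^ n * f t) integrable_on {0..1}"
proof -
  obtain K where "\<And>g :: real \<Rightarrow> real. mono_on {0..1} g \<Longrightarrow> g 0 \<ge> 0 \<Longrightarrow>
      (\<lambda>x. of_real (g x) * f x) integrable_on {0..1} \<and>
      norm (integral {0..1} (\<lambda>x. of_real (g x) * f x)) \<le> K * g 1"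
    by (rule monotone_weight_integral_bound[OF assms zero_le_one]) blast
  \<comment> \<open>The power itself is an increasing nonnegative weight, so the moments exist even
    when \<open>f\<close> is not absolutely integrable.\<close>
  from this[of "\<lambda>t. t ^ n"] show ?thesis
    by (auto simp: mono_on_def intro: power_mono)
qed

lemma summable_power_series_unit_interval:
  fixes a :: "nat \<Rightarrow> 'a :: {real_normed_field, banach}" and t :: real
  assumes "summable (\<lambda>n. norm (a n))" and "t \<in> {0..1}"
  shows "summable (\<lambda>n. a n * of_real t ^ n)"
proof (rule summable_comparison_test'[OF assms(1), of 0])
  fix n :: nat
  have "norm (a n) * t ^ n \<le> norm (a n)"
    using assms(2) by (intro mult_left_le power_le_one) auto
  thus "norm (a n * of_real t ^ n) \<le> norm (a n)"
    using assms(2) by (simp add: norm_mult norm_power)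
qed

text \<open>All remainders \<open>R N\<close> are admissible weights with the same constant
  \<open>K\<close>, so their integrals against \<open>f\<close> are bounded by
  \<open>K * R N 1\<close>, a multiple of the tail of the convergent series of the
  \<open>a n\<close>.\<close>

lemma power_series_integral_nonneg:
  fixes f :: "real \<Rightarrow> complex" and a :: "nat \<Rightarrow> real"
  assumes f: "f integrable_on {0..1}" and a: "summable a" "\<And>n. a n \<ge> 0"
  shows "(\<lambda>t. of_real (\<Sum>n. a n * t ^ n) * f t) integrable_on {0..1}"
    and "(\<lambda>n. of_real (a n) * integral {0..1} (\<lambda>t. of_real t ^ n * f t)) sums
           integral {0..1} (\<lambda>t. of_real (\<Sum>n. a n * t ^ n) * f t)"
proof -
  obtain K where K: "\<And>g :: real \<Rightarrow> real. mono_on {0..1} g \<Longrightarrow> g 0 \<ge> 0 \<Longrightarrow>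
      (\<lambda>x. of_real (g x) * f x) integrable_on {0..1} \<and>
      norm (integral {0..1} (\<lambda>x. of_real (g x) * f x)) \<le> K * g 1"
    by (rule monotone_weight_integral_bound[OF f zero_le_one]) blast
  define R where "R N t = (\<Sum>n. a (n + N) * t ^ (n + N))" for N and t :: real
  have summ: "summable (\<lambda>n. a (n + N) * t ^ (n + N))" if "t \<in> {0..1}" for t N
    using summable_power_series_unit_interval[of a t] a that
    by (intro summable_ignore_initial_segment) simp
  have mono: "mono_on {0..1} (R N)" for N
    unfolding R_def using a(2)
    by (intro mono_onI suminf_le summ mult_left_mono power_mono) auto
  have R0: "R N 0 \<ge> 0" for N
    unfolding R_def using a(2) summ[of 0 N] by (intro suminf_nonneg) auto
  note R = K[OF mono R0]
  have split: "R 0 t = R N t + (\<Sum>n<N. a n * t ^ n)" if "t \<in> {0..1}" for t N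
    using suminf_split_initial_segment[OF summ[OF that, of 0], of N] by (simp add: R_def)
  \<comment> \<open>The remainder \<open>R 0\<close> is the whole series.\<close>
  show int: "(\<lambda>t. of_real (\<Sum>n. a n * t ^ n) * f t) integrable_on {0..1}"
    using R[of 0] by (simp add: R_def)
  define m where "m n = integral {0..1} (\<lambda>t. of_real t ^ n * f t)" for n
  have m: "((\<lambda>t. of_real t ^ n * f t) has_integral m n) {0..1}" for n
    unfolding m_def by (intro integrable_integral power_moment_integrable f)
  \<comment> \<open>The error of the \<open>N\<close>-th partial sum is the integral of the
    remainder; this takes only finite linearity.\<close>
  have diff: "integral {0..1} (\<lambda>t. of_real (R 0 t) * f t) - (\<Sum>n<N. of_real (a n) * m n) =
                integral {0..1} (\<lambda>t. of_real (R N t) * f t)" for N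
  proof -
    have "((\<lambda>t. of_real (R 0 t) * f t - (\<Sum>n<N. of_real (a n) * (of_real t ^ n * f t))) has_integral
            integral {0..1} (\<lambda>t. of_real (R 0 t) * f t) - (\<Sum>n<N. of_real (a n) * m n)) {0..1}"
      using R[of 0] by (intro has_integral_diff has_integral_sum has_integral_mult_right m integrable_integral) auto
    moreover have "of_real (R 0 t) * f t - (\<Sum>n<N. of_real (a n) * (of_real t ^ n * f t)) =
        of_real (R N t) * f t" if "t \<in> {0..1}" for t
      by (simp add: split[OF that, of N] sum_distrib_left algebra_simps)
    ultimately have "((\<lambda>t. of_real (R N t) * f t) has_integral
            integral {0..1} (\<lambda>t. of_real (R 0 t) * f t) - (\<Sum>n<N. of_real (a n) * m n)) {0..1}"
      by (rule has_integral_eq[rotated])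
    thus ?thesis by (simp add: integral_unique)
  qed
  have "(\<lambda>N. R N 1) \<longlonglongrightarrow> 0"
    using suminf_exist_split2[OF a(1)] by (simp add: R_def)
  hence "(\<lambda>N. K * R N 1) \<longlonglongrightarrow> 0"
    by (intro tendsto_mult_right_zero)
  hence "(\<lambda>N. integral {0..1} (\<lambda>t. of_real (R N t) * f t)) \<longlonglongrightarrow> 0"
    by (rule Lim_null_comparison[rotated]) (use R in auto)
  hence "(\<lambda>N. integral {0..1} (\<lambda>t. of_real (R 0 t) * f t) -
            integral {0..1} (\<lambda>t. of_real (R N t) * f t)) \<longlonglongrightarrow>
          integral {0..1} (\<lambda>t. of_real (R 0 t) * f t) - 0"
    by (intro tendsto_diff tendsto_const)
  moreover have "integral {0..1} (\<lambda>t. of_real (R 0 t) * f t) -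
      integral {0..1} (\<lambda>t. of_real (R N t) * f t) = (\<Sum>n<N. of_real (a n) * m n)" for N
    using diff[of N] by (simp add: algebra_simps)
  ultimately show "(\<lambda>n. of_real (a n) * integral {0..1} (\<lambda>t. of_real t ^ n * f t)) sums
           integral {0..1} (\<lambda>t. of_real (\<Sum>n. a n * t ^ n) * f t)"
    by (simp add: sums_def m_def R_def)
qed

lemma power_series_integral_real:
  fixes f :: "real \<Rightarrow> complex" and a :: "nat \<Rightarrow> real"
  assumes f: "f integrable_on {0..1}" and a: "summable (\<lambda>n. \<bar>a n\<bar>)"
  obtains I where "((\<lambda>t. of_real (\<Sum>n. a n * t ^ n) * f t) has_integral I) {0..1}"
    and "(\<lambda>n. of_real (a n) * integral {0..1} (\<lambda>t. of_real t ^ n * f t)) sums I"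
proof -
  \<comment> \<open>Both sequences are nonnegative and summable, and \<open>a n = p n - q n\<close>,
    so the nonnegative case applies to each.\<close>
  define p q where "p n = \<bar>a n\<bar>" and "q n = \<bar>a n\<bar> - a n" for n
  have pq: "summable p" "summable q" "p n \<ge> 0" "q n \<ge> 0" for n
    unfolding p_def q_def using a summable_diff[OF a summable_rabs_cancel[OF a]] by simp_all
  note P = power_series_integral_nonneg[OF f pq(1,3)]
  note Q = power_series_integral_nonneg[OF f pq(2,4)]
  have eq: "(\<Sum>n. a n * t ^ n) = (\<Sum>n. p n * t ^ n) - (\<Sum>n. q n * t ^ n)" if "t \<in> {0..1}" for t
  proof -
    have "summable (\<lambda>n. p n * t ^ n)" "summable (\<lambda>n. q n * t ^ n)"
      using summable_power_series_unit_interval[of p t] summable_power_series_unit_interval[of q t] pq that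
      by simp_all
    from suminf_diff[OF this] show ?thesis
      by (simp add: p_def q_def algebra_simps)
  qed
  show thesis
  proof
    show "((\<lambda>t. of_real (\<Sum>n. a n * t ^ n) * f t) has_integral
        integral {0..1} (\<lambda>t. of_real (\<Sum>n. p n * t ^ n) * f t) -
        integral {0..1} (\<lambda>t. of_real (\<Sum>n. q n * t ^ n) * f t)) {0..1}"
      by (rule has_integral_eq[OF _ has_integral_diff[OF integrable_integral[OF P(1)] integrable_integral[OF Q(1)]]])
         (simp add: eq algebra_simps)
    show "(\<lambda>n. of_real (a n) * integral {0..1} (\<lambda>t. of_real t ^ n * f t)) sums
        (integral {0..1} (\<lambda>t. of_real (\<Sum>n. p n * t ^ n) * f t) -
         integral {0..1} (\<lambda>t. of_real (\<Sum>n. q n * t ^ n) * f t))"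
      using sums_diff[OF P(2) Q(2)] by (simp add: p_def q_def algebra_simps)
  qed
qed

text \<open>Since \<open>t ^ n\<close> is real, the real and imaginary parts of the coefficients
  give two real power series. The results are recombined as \<open>I + \<i> * J\<close>, where
  \<open>I\<close> and \<open>J\<close> may themselves be complex.\<close>

lemma power_series_integral:
  fixes f :: "real \<Rightarrow> complex" and a :: "nat \<Rightarrow> complex"
  assumes f: "f integrable_on {0..1}" and a: "summable (\<lambda>n. norm (a n))"
  obtains I where "((\<lambda>t. (\<Sum>n. a n * of_real t ^ n) * f t) has_integral I) {0..1}"
    and "(\<lambda>n. a n * integral {0..1} (\<lambda>t. of_real t ^ n * f t)) sums I"
proof -
  have re: "summable (\<lambda>n. \<bar>Re (a n)\<bar>)" and im: "summable (\<lambda>n. \<bar>Im (a n)\<bar>)"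
    by (rule summable_comparison_test'[OF a, of 0]; simp add: abs_Re_le_cmod abs_Im_le_cmod)+
  obtain I where
    I: "((\<lambda>t. of_real (\<Sum>n. Re (a n) * t ^ n) * f t) has_integral I) {0..1}"
       "(\<lambda>n. of_real (Re (a n)) * integral {0..1} (\<lambda>t. of_real t ^ n * f t)) sums I"
    by (rule power_series_integral_real[OF f re])
  obtain J where
    J: "((\<lambda>t. of_real (\<Sum>n. Im (a n) * t ^ n) * f t) has_integral J) {0..1}"
       "(\<lambda>n. of_real (Im (a n)) * integral {0..1} (\<lambda>t. of_real t ^ n * f t)) sums J"
    by (rule power_series_integral_real[OF f im])
  have eq: "(\<Sum>n. a n * of_real t ^ n) =
      of_real (\<Sum>n. Re (a n) * t ^ n) + \<i> * of_real (\<Sum>n. Im (a n) * t ^ n)"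
    if "t \<in> {0..1}" for t :: real
  proof -
    have s: "(\<lambda>n. a n * of_real t ^ n) sums (\<Sum>n. a n * of_real t ^ n)"
      by (intro summable_sums summable_power_series_unit_interval a that)
    have "Re (a n * of_real t ^ n) = Re (a n) * t ^ n" "Im (a n * of_real t ^ n) = Im (a n) * t ^ n" for n
      by (simp_all flip: of_real_power)
    thus ?thesis
      using sums_unique[OF sums_Re[OF s]] sums_unique[OF sums_Im[OF s]]
      by (simp add: complex_eq_iff)
  qed
  show thesis
  proof
    show "((\<lambda>t. (\<Sum>n. a n * of_real t ^ n) * f t) has_integral I + \<i> * J) {0..1}"
      by (rule has_integral_eq[OF _ has_integral_add[OF I(1) has_integral_mult_right[OF J(1)]]])
         (simp add: eq algebra_simps)
    have "of_real (Re (a n)) * x + \<i> * (of_real (Im (a n)) * x) = a n * x" for n x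
      by (simp add: complex_eq_iff algebra_simps)
    thus "(\<lambda>n. a n * integral {0..1} (\<lambda>t. of_real t ^ n * f t)) sums (I + \<i> * J)"
      using sums_add[OF I(2) sums_mult[OF J(2), of \<i>]] by simp
  qed
qed

section \<open>The exponential weight and the symmetries of the integrand\<close>

lemma exp_weight_integral:
  fixes f :: "real \<Rightarrow> complex"
  assumes "f integrable_on {0..1}"
  shows "(\<lambda>t. exp (z * of_real t) * f t) integrable_on {0..1}"
    and "(\<lambda>n. z ^ n / fact n * integral {0..1} (\<lambda>t. of_real t ^ n * f t)) sums
           integral {0..1} (\<lambda>t. exp (z * of_real t) * f t)"
proof -
  \<comment> \<open>This is absolute convergence of the exponential series at \<open>z\<close>, that
    is, of the weight at the right end point \<open>t = 1\<close>.\<close>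
  have "summable (\<lambda>n. norm (z ^ n / fact n))"
    using summable_norm_exp[of z] by (simp add: scaleR_conv_of_real divide_inverse norm_mult norm_inverse mult.commute)
  then obtain I where I: "((\<lambda>t. (\<Sum>n. z ^ n / fact n * of_real t ^ n) * f t) has_integral I) {0..1}"
    "(\<lambda>n. z ^ n / fact n * integral {0..1} (\<lambda>t. of_real t ^ n * f t)) sums I"
    by (rule power_series_integral[OF assms])
  have "(\<Sum>n. z ^ n / fact n * of_real t ^ n) = exp (z * of_real t)" for t
    by (simp add: exp_def scaleR_conv_of_real power_mult_distrib field_simps)
  with I show "(\<lambda>t. exp (z * of_real t) * f t) integrable_on {0..1}"
    "(\<lambda>n. z ^ n / fact n * integral {0..1} (\<lambda>t. of_real t ^ n * f t)) sums
           integral {0..1} (\<lambda>t. exp (z * of_real t) * f t)"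
    by (auto simp: integral_unique)
qed

text \<open>This turns the beta values in the series of \<open>Phi_ML\<close> into moments of one
  fixed integrand.\<close>

lemma beta_ML_integrand_add_nat:
  "beta_ML_integrand \<alpha> \<beta> \<gamma> p (x + of_nat n) y t = of_real t ^ n * beta_ML_integrand \<alpha> \<beta> \<gamma> p x y t"
\<comment> \<open>The point 0 is separate because \<open>0 powr 0\<close> is 0 whereas
  \<open>0 ^ 0\<close> is 1. There both sides vanish through the factor
  \<open>0 powr (x - 1)\<close> and its shifted counterpart.\<close>
proof (cases "t = 0")
  case False
  hence "complex_of_real t powr (x + of_nat n - 1) = of_real t ^ n * of_real t powr (x - 1)"
    using powr_add[of "of_real t" "x - 1" "of_nat n"] by (simp add: powr_nat' algebra_simps)
  thus ?thesis by (simp add: beta_ML_integrand_def)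
qed (simp add: beta_ML_integrand_def)

text \<open>The affine substitution has slope -1, whose absolute value 1 leaves the integral
  unscaled. It carries the first integral representation to the second.\<close>

lemma has_integral_reflect_unit_interval:
  fixes f :: "real \<Rightarrow> 'a :: real_normed_vector"
  assumes "(f has_integral I) {0..1}"
  shows "((\<lambda>t. f (1 - t)) has_integral I) {0..1}"
  using has_integral_affinity[of f I 0 1 "-1" 1] assms by (simp add: image_affinity_atLeastAtMost_diff)

theorem theorem3p2:
  fixes \<alpha> \<beta> \<gamma> b c z :: complex and p :: real
  assumes "p \<ge> 0" and "Re c > Re b" and "Re b > 0" and "Re \<alpha> > 0"
    and "beta_ML_integrand \<alpha> \<beta> \<gamma> p b (c - b) integrable_on {0..1}"
  shows
    "let f = (\<lambda>t::real. of_real t powr (b - 1) * of_real (1 - t) powr (c - b - 1) *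
               exp (z * of_real t) *
               mittag_leffler3 \<alpha> \<beta> \<gamma> (of_real (- (p / (t * (1 - t))))));
         g = (\<lambda>t::real. of_real t powr (c - b - 1) * of_real (1 - t) powr (b - 1) *
               exp (z * of_real (1 - t)) *
               mittag_leffler3 \<alpha> \<beta> \<gamma> (of_real (- (p / (t * (1 - t))))))
     in summable (Phi_ML_summand \<alpha> \<beta> \<gamma> p b c z) \<and>
        f integrable_on {0..1} \<and>
        Phi_ML \<alpha> \<beta> \<gamma> p b c z = 1 / Beta b (c - b) * integral {0..1} f \<and>
        g integrable_on {0..1} \<and>
        Phi_ML \<alpha> \<beta> \<gamma> p b c z = 1 / Beta b (c - b) * integral {0..1} g"
proof -
  let ?h = "beta_ML_integrand \<alpha> \<beta> \<gamma> p b (c - b)"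
  define f where "f = (\<lambda>t::real. of_real t powr (b - 1) * of_real (1 - t) powr (c - b - 1) *
               exp (z * of_real t) * mittag_leffler3 \<alpha> \<beta> \<gamma> (of_real (- (p / (t * (1 - t))))))"
  define g where "g = (\<lambda>t::real. of_real t powr (c - b - 1) * of_real (1 - t) powr (b - 1) *
               exp (z * of_real (1 - t)) * mittag_leffler3 \<alpha> \<beta> \<gamma> (of_real (- (p / (t * (1 - t))))))"
  have f: "f = (\<lambda>t. exp (z * of_real t) * ?h t)"
    by (simp add: f_def beta_ML_integrand_def fun_eq_iff algebra_simps)
  \<comment> \<open>Reflection exchanges the two powers and leaves \<open>t * (1 - t)\<close>, hence
    the Mittag-Leffler factor, unchanged.\<close>
  have g: "g = (\<lambda>t. f (1 - t))"
    by (simp add: f_def g_def fun_eq_iff algebra_simps)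
  have int_f: "f integrable_on {0..1}"
    unfolding f by (rule exp_weight_integral(1)) fact
  have "((\<lambda>t. f (1 - t)) has_integral integral {0..1} f) {0..1}"
    using int_f by (intro has_integral_reflect_unit_interval integrable_integral)
  hence g': "g integrable_on {0..1}" "integral {0..1} g = integral {0..1} f"
    unfolding g by (auto simp: integral_unique)
  \<comment> \<open>Up to the common factor \<open>1 / Beta b (c - b)\<close>, the summands are
    those of the exponential series integrated termwise against \<open>?h\<close>.\<close>
  have "Phi_ML_summand \<alpha> \<beta> \<gamma> p b c z n =
      1 / Beta b (c - b) * (z ^ n / fact n * integral {0..1} (\<lambda>t. of_real t ^ n * ?h t))" for n
    by (simp add: Phi_ML_summand_def beta_ML_def beta_ML_integrand_add_nat[abs_def])
  hence "Phi_ML_summand \<alpha> \<beta> \<gamma> p b c z = (\<lambda>n. 1 / Beta b (c - b) *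
      (z ^ n / fact n * integral {0..1} (\<lambda>t. of_real t ^ n * ?h t)))"
    by blast
  moreover have "(\<lambda>n. z ^ n / fact n * integral {0..1} (\<lambda>t. of_real t ^ n * ?h t)) sums integral {0..1} f"
    unfolding f by (rule exp_weight_integral(2)) fact
  ultimately have "Phi_ML_summand \<alpha> \<beta> \<gamma> p b c z sums (1 / Beta b (c - b) * integral {0..1} f)"
    by (simp only: sums_mult)
  hence "summable (Phi_ML_summand \<alpha> \<beta> \<gamma> p b c z)"
    "Phi_ML \<alpha> \<beta> \<gamma> p b c z = 1 / Beta b (c - b) * integral {0..1} f"
    by (auto simp: Phi_ML_def sums_iff)
  thus ?thesis
    using int_f g' unfolding Let_def f_def[symmetric] g_def[symmetric] by simp
qed

end
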